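(* Let $T\ge 1$ be an integer and consider a reverse-time Markov process $x_T, x_{T-1},\dots,x_0$ on $\mathbb{R}^d$ with transition densities $p(x_{t-1}\mid x_t)$, $t\in\{1,\dots,T\}$, and marginal densities $p(x_t)$, $t\in\{0,\dots,T\}$. Let $p_{\mathcal{Y}}:\mathbb{R}^d\to[0,\infty)$ be a predefined function and let $h(x_t,t)$, $x_t\in\mathbb{R}^d$, $t\in\{0,\dots,T\}$, be a real-valued function, positive for $t\in\{1,\dots,T\}$, such that $h(x_0,0)=p_{\mathcal{Y}}(x_0)$ for all $x_0$ and $$h(x_t,t)=\int p(x_{t-1}\mid x_t)\,h(x_{t-1},t-1)\,dx_{t-1}\qquad\text{for all } t\in\{1,\dots,T\}\text{ and all } x_t.$$ Assume $0<\mathbb{E}_{p(x_0)}[h(x_0,0)]<\infty$. Consider the reverse-time Markov process (the "bridge") with transition densities $$p^h(x_{t-1}\mid x_t)=p(x_{t-1}\mid x_t)\,\frac{h(x_{t-1},t-1)}{h(x_t,t)},\qquad t\in\{1,\dots,T\},$$ and with density at time $T$ equal to $$p^h(x_T)=\frac{p(x_T)\,h(x_T,T)}{\mathbb{E}_{p(x_0)}[h(x_0,0)]}.$$ Then the density $p^h(x_0)$ of the bridge at time $0$ is proportional to $p(x_0)\,p_{\mathcal{Y}}(x_0)$ as a function of $x_0$.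
   Context: Time is discrete, $t\in\{0,1,\dots,T\}$. All distributions are given by (measurable) densities with respect to Lebesgue measure on $\mathbb{R}^d$, and all functions are measurable. A reverse-time Markov process starts from an initial density at time $T$ and evolves from time $t$ to time $t-1$ according to a transition density $x_{t-1}\mapsto p(x_{t-1}\mid x_t)$ that depends only on $x_t$; its marginal densities satisfy $p(x_{t-1})=\int p(x_{t-1}\mid x_t)\,p(x_t)\,dx_t$. Likewise, $p^h(x_t)$ denotes the marginal density of the bridge at time $t$, so that $p^h(x_{t-1})=\int p^h(x_{t-1}\mid x_t)\,p^h(x_t)\,dx_t$. The function $p_{\mathcal{Y}}(x_0)$ quantifies how likely $x_0$ is to possess some target attributes $\mathcal{Y}$; it is nonnegative and is zero for those $x_0$ without these attributes. $\mathbb{E}_{p(x_0)}[h(x_0,0)]=\int p(x_0)\,h(x_0,0)\,dx_0$. *)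

theory Defs
  imports "HOL-Probability.Probability"
begin

(* Densities are ennreal-valued, as in the library predicate distributed.
   The conditioning variable is the last argument:  p t y x  stands for
   p(x_{t-1} = y | x_t = x). *)
definition transition_density ::
  "(real ^ 'd \<Rightarrow> real ^ 'd \<Rightarrow> ennreal) \<Rightarrow> bool" where
  "transition_density k \<longleftrightarrow>
     (\<lambda>(y, x). k y x) \<in> borel_measurable (borel \<Otimes>\<^sub>M borel) \<and>
     (\<forall>x. (\<integral>\<^sup>+ y. k y x \<partial>lborel) = 1)"

(* The third conjunct says that X t has density m t; the fourth that the process starts at
   time T from the density m T and that, given X T, ..., X t, the next state X (t - 1) has
   density p t _ (X t), i.e. that the joint density of the path factorises.
   Together they determine each m t with t < T up to a null set only; the
   last conjunct selects the version for which the recursion holds at every point.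
   It is in general only almost everywhere finite, hence the type ennreal. *)
definition reverse_markov_process ::
  "'w measure \<Rightarrow> nat \<Rightarrow> (nat \<Rightarrow> 'w \<Rightarrow> real ^ 'd) \<Rightarrow>
   (nat \<Rightarrow> real ^ 'd \<Rightarrow> real ^ 'd \<Rightarrow> ennreal) \<Rightarrow>
   (nat \<Rightarrow> real ^ 'd \<Rightarrow> ennreal) \<Rightarrow> bool" where
  "reverse_markov_process M T X p m \<longleftrightarrow>
     prob_space M \<and>
     (\<forall>t\<in>{1..T}. transition_density (p t)) \<and>
     (\<forall>t\<in>{0..T}. distributed M lborel (X t) (m t)) \<and>
     distributed M (\<Pi>\<^sub>M t\<in>{0..T}. lborel) (\<lambda>\<omega>. \<lambda>t\<in>{0..T}. X t \<omega>)
       (\<lambda>x. m T (x T) * (\<Prod>t\<in>{1..T}. p t (x (t - 1)) (x t))) \<and>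
     (\<forall>t\<in>{1..T}. \<forall>y. m (t - 1) y = (\<integral>\<^sup>+ x. p t y x * m t x \<partial>lborel))"

definition bridge_transition ::
  "(nat \<Rightarrow> real ^ 'd \<Rightarrow> real ^ 'd \<Rightarrow> ennreal) \<Rightarrow> (real ^ 'd \<Rightarrow> nat \<Rightarrow> real) \<Rightarrow>
   nat \<Rightarrow> real ^ 'd \<Rightarrow> real ^ 'd \<Rightarrow> ennreal" where
  "bridge_transition p h t y x = p t y x * ennreal (h y (t - 1) / h x t)"

end

(* Downward induction on t shows that the bridge has marginals p(x_t) h(x_t,t) / E: in the
   recursion for the marginals the factor h(x_t,t) of the density at time t cancels the
   denominator of the bridge transition. At t = 0 this is the claim, with constant 1 / E. *)
theory Submission
  imports Defs
begin

text \<open>The equation holds at every point, not just almost everywhere, because both processes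
  satisfy their marginal recursions pointwise. The normaliser \<open>E\<close> enters only as a
  constant factor passed down from time \<open>T\<close>.\<close>

lemma h_transform_marginal:
  fixes p :: "nat \<Rightarrow> real ^ 'd \<Rightarrow> real ^ 'd \<Rightarrow> ennreal"
    and h :: "real ^ 'd \<Rightarrow> nat \<Rightarrow> real" and E :: ennreal
  assumes process: "reverse_markov_process M T X p m"
    and bridge: "reverse_markov_process N T Z (bridge_transition p h) mh"
    and h_pos: "\<And>t x. t \<in> {1..T} \<Longrightarrow> 0 < h x t"
    and h_0: "\<And>x. 0 \<le> h x 0"
    and bridge_T: "\<And>x. mh T x = m T x * ennreal (h x T) / E"
    and "t \<le> T"
  shows "mh t y = m t y * ennreal (h y t) / E"
  using \<open>t \<le> T\<close>
\<comment> \<open>The point \<open>y\<close> is generalised because the hypothesis at time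
  \<open>Suc n\<close> is applied at the integration variable \<open>x\<close>.\<close>
proof (induction arbitrary: y rule: inc_induct)
  case base
  show ?case by (rule bridge_T)
next
  case (step n)
  then have n: "Suc n \<in> {1..T}" by simp
  have m_step: "m n y = (\<integral>\<^sup>+ x. p (Suc n) y x * m (Suc n) x \<partial>lborel)"
    using process n unfolding reverse_markov_process_def by fastforce
  have mh_step: "mh n y = (\<integral>\<^sup>+ x. bridge_transition p h (Suc n) y x * mh (Suc n) x \<partial>lborel)"
    using bridge n unfolding reverse_markov_process_def by fastforce
  have [measurable]: "(\<lambda>(y, x). p (Suc n) y x) \<in> borel_measurable (borel \<Otimes>\<^sub>M borel)"
    using process n unfolding reverse_markov_process_def transition_density_def by blast
  have "distributed M lborel (X (Suc n)) (m (Suc n))"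
    using process n unfolding reverse_markov_process_def by simp
  then have [measurable]: "m (Suc n) \<in> borel_measurable borel"
    using distributed_borel_measurable by fastforce
  \<comment> \<open>The target time \<open>n\<close> may be 0, where \<open>h\<close> may vanish;
    the denominator is taken at \<open>Suc n\<close>, where it is positive.\<close>
  have h_nonneg: "0 \<le> h y n"
    using h_0 h_pos[of n y] step.hyps by (cases n) auto
  \<comment> \<open>Only the finite positive number \<open>h x (Suc n)\<close> is cancelled, so
    infinite values of \<open>m\<close> do no harm. What remains of \<open>h\<close> and
    \<open>E\<close> is free of \<open>x\<close> and leaves the integral.\<close>
  have cancel: "bridge_transition p h (Suc n) y x * mh (Suc n) x =
      p (Suc n) y x * m (Suc n) x * (ennreal (h y n) / E)" for x
  proof -
    have "ennreal (h y n / h x (Suc n)) * ennreal (h x (Suc n)) = ennreal (h y n)"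
      using h_pos[OF n, of x] h_nonneg by (simp flip: ennreal_mult)
    then show ?thesis
      by (simp add: bridge_transition_def step.IH divide_ennreal_def mult_ac)
  qed
  show ?case
    unfolding mh_step cancel m_step
    by (subst nn_integral_multc) (auto simp: divide_ennreal_def mult.assoc)
qed

theorem corollary1:
  fixes T :: nat
    and M :: "'w measure" and X :: "nat \<Rightarrow> 'w \<Rightarrow> real ^ 'd"
    and p :: "nat \<Rightarrow> real ^ 'd \<Rightarrow> real ^ 'd \<Rightarrow> ennreal"
    and m :: "nat \<Rightarrow> real ^ 'd \<Rightarrow> ennreal"
    and pY :: "real ^ 'd \<Rightarrow> real"
    and h :: "real ^ 'd \<Rightarrow> nat \<Rightarrow> real"
    and E :: ennreal
    and N :: "'v measure" and Z :: "nat \<Rightarrow> 'v \<Rightarrow> real ^ 'd"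
    and mh :: "nat \<Rightarrow> real ^ 'd \<Rightarrow> ennreal"
  assumes "T \<ge> 1"
    and process: "reverse_markov_process M T X p m"
    and pY_measurable: "pY \<in> borel_measurable borel"
    and pY_nonneg: "\<And>x. 0 \<le> pY x"
    and h_measurable: "\<And>t. t \<in> {0..T} \<Longrightarrow> (\<lambda>x. h x t) \<in> borel_measurable borel"
    and h_pos: "\<And>t x. t \<in> {1..T} \<Longrightarrow> 0 < h x t"
    and h_0: "\<And>x. h x 0 = pY x"
    and h_step: "\<And>t x. t \<in> {1..T} \<Longrightarrow>
      ennreal (h x t) = (\<integral>\<^sup>+ y. p t y x * ennreal (h y (t - 1)) \<partial>lborel)"
    and E_def: "E = (\<integral>\<^sup>+ x. m 0 x * ennreal (h x 0) \<partial>lborel)"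
    and E_bounds: "0 < E" "E < \<infinity>"
    and bridge: "reverse_markov_process N T Z (bridge_transition p h) mh"
    and bridge_T: "\<And>x. mh T x = m T x * ennreal (h x T) / E"
  shows "\<exists>c::real. 0 < c \<and> (\<forall>x. mh 0 x = ennreal c * (m 0 x * ennreal (pY x)))"
proof (intro exI conjI allI)
  \<comment> \<open>The witness is \<open>1 / E\<close> as a real number: \<open>0 < E\<close> makes
    \<open>inverse E\<close> finite, so \<open>enn2real\<close> loses nothing.\<close>
  have inv: "ennreal (enn2real (inverse E)) = inverse E"
    using E_bounds by (simp add: less_top[symmetric])
  \<comment> \<open>Since \<open>E\<close> is finite, \<open>inverse E\<close> is not 0; since it is
    also not infinite, \<open>enn2real\<close> does not send it to its default value 0.\<close>
  show "0 < enn2real (inverse E)"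
    using E_bounds by (simp add: enn2real_positive_iff zero_less_iff_neq_zero less_top[symmetric])
  have "0 \<le> h x 0" for x
    using h_0 pY_nonneg by simp
  then have "mh 0 x = m 0 x * ennreal (h x 0) / E" for x
    using h_transform_marginal[OF process bridge h_pos _ bridge_T] by blast
  then show "mh 0 x = ennreal (enn2real (inverse E)) * (m 0 x * ennreal (pY x))" for x
    by (simp add: inv h_0 divide_ennreal_def mult_ac)
qed

end
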